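(* Let $K\subset L$ be commutative fields such that every element of $L$ that is algebraic over $K$ is separable over $K$. Let $B$ be a finite-dimensional $K$-subspace of $L$ containing $1$, and let $n\geq1$. Then either $\langle B^{n+1}\rangle=\langle B^n\rangle$ or $$\dim_K\langle B^{n+1}\rangle\geq\dim_K\langle B^{n-1}\rangle+\dim_KB.$$
   Context: For $S\subset L$, $\langle S\rangle$ denotes the $K$-subspace of $L$ spanned by $S$. $B^m=\{b_1\cdots b_m\mid b_i\in B\}$ is the $m$-fold product set for $m\geq1$, and by convention $\langle B^0\rangle=K$. *)

theory Defs
  imports "HOL-Computational_Algebra.Polynomial"
begin

text \<open>The field K is a type 'k, embedded into the field L (type 'a) by a field
  homomorphism emb.  The K-vector space structure of L is given by the scalar
  multiplication (\<lambda>c x. emb c * x).\<close>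

definition kscale :: "('k::field \<Rightarrow> 'a::field) \<Rightarrow> 'k \<Rightarrow> 'a \<Rightarrow> 'a" where
  "kscale emb c x = emb c * x"

definition is_field_emb :: "('k::field \<Rightarrow> 'a::field) \<Rightarrow> bool" where
  "is_field_emb emb \<longleftrightarrow> (\<forall>x y. emb (x + y) = emb x + emb y) \<and>
     (\<forall>x y. emb (x * y) = emb x * emb y) \<and> emb 1 = 1"

definition algebraic_over :: "('k::field \<Rightarrow> 'a::field) \<Rightarrow> 'a \<Rightarrow> bool" where
  "algebraic_over emb a \<longleftrightarrow> (\<exists>p::'k poly. p \<noteq> 0 \<and> poly (map_poly emb p) a = 0)"

definition separable_poly :: "'k::field poly \<Rightarrow> bool" where
  "separable_poly p \<longleftrightarrow> coprime p (pderiv p)"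

text \<open>a is separable over K: its minimal polynomial (an irreducible polynomial over K
  vanishing at a, unique up to a unit) is separable.\<close>
definition separable_over :: "('k::field \<Rightarrow> 'a::field) \<Rightarrow> 'a \<Rightarrow> bool" where
  "separable_over emb a \<longleftrightarrow>
     (\<exists>p::'k poly. irreducible p \<and> poly (map_poly emb p) a = 0 \<and> separable_poly p)"

definition prod_set_pow :: "'a::comm_monoid_mult set \<Rightarrow> nat \<Rightarrow> 'a set" where
  "prod_set_pow B m = {(\<Prod>i<m. f i) | f. \<forall>i<m. f i \<in> B}"

end

theory Submission
  imports Defs "HOL-Computational_Algebra.Formal_Laurent_Series"
    "HOL-Computational_Algebra.Polynomial_Factorial"
begin

text \<open>
  The growth statement is deduced from a linear version of Kneser's addition theorem:
  \<open>dim \<langle>AB\<rangle> + dim H \<ge> dim A + dim B\<close>, where \<open>H\<close> is the stabiliser of \<open>\<langle>AB\<rangle>\<close> in \<open>L\<close>.  With \<open>H\<close> the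
  stabiliser of \<open>\<langle>B^{n+1}\<rangle>\<close> one applies it to \<open>\<langle>HB^n\<rangle>\<close> and \<open>\<langle>HB\<rangle>\<close>: either \<open>\<langle>HB^n\<rangle>\<close> has at least
  \<open>dim H\<close> more dimensions than \<open>\<langle>HB^{n-1}\<rangle>\<close>, or \<open>\<langle>B^{n+1}\<rangle> = H\<close> is a field.

  Given \<open>a \<noteq> 0\<close> in \<open>A\<close>, Dyson's transform yields a space \<open>V\<close> with \<open>aB \<subseteq> V \<subseteq> \<langle>AB\<rangle>\<close> and
  \<open>dim V + dim Stab V \<ge> dim A + dim B\<close>, but \<open>Stab V\<close> need not stabilise \<open>\<langle>AB\<rangle>\<close>.  This is repaired by
  making \<open>a\<close> generic: extend scalars from \<open>K \<subseteq> L\<close> to the Laurent series fields \<open>K((t)) \<subseteq> L((t))\<close> and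
  take \<open>a = \<Sum> a\<^sub>i t\<^sup>i\<close> with \<open>a\<^sub>i\<close> a basis of \<open>A\<close>.  Let \<open>x \<in> Stab V\<close>.  In characteristic \<open>p\<close>, for a power
  \<open>q\<close> of \<open>p\<close> larger than \<open>dim A\<close> the coefficients of \<open>x^q a b\<close> are the products \<open>x\<^sub>j^q a\<^sub>i b\<close>, so all
  \<open>x\<^sub>j^q\<close> stabilise \<open>\<langle>AB\<rangle>\<close>, and by separability so do the \<open>x\<^sub>j\<close>.  In characteristic \<open>0\<close>, \<open>Stab V\<close> is
  closed under the derivation \<open>t d/dt\<close>, which again separates the terms \<open>a\<^sub>i t\<^sup>i\<close>.  Thus
  \<open>Stab V \<subseteq> (Stab \<langle>AB\<rangle>)((t))\<close>.
\<close>

section \<open>Stabilisers and Dyson transforms\<close>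

text \<open>For a nonzero finite-dimensional subspace this is a field between \<open>K\<close> and
  \<open>L\<close>; keeping \<open>0\<close> among the multipliers makes it a subspace as
  well.\<close>

definition mult_stab :: "'a::times set \<Rightarrow> 'a set" where
  "mult_stab V = {x. \<forall>v\<in>V. x * v \<in> V}"

definition set_prods :: "'a::times set \<Rightarrow> 'a set \<Rightarrow> 'a set" where
  "set_prods A B = {x * y |x y. x \<in> A \<and> y \<in> B}"

lemma set_prodsI: "x \<in> A \<Longrightarrow> y \<in> B \<Longrightarrow> x * y \<in> set_prods A B"
  by (auto simp: set_prods_def)

lemma mult_stab_1: "(1::'a::monoid_mult) \<in> mult_stab V"
  by (simp add: mult_stab_def)

lemma mult_stab_mult: "(x::'a::semigroup_mult) \<in> mult_stab V \<Longrightarrow> y \<in> mult_stab V \<Longrightarrow> x * y \<in> mult_stab V"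
  by (auto simp: mult_stab_def mult.assoc)

lemma mult_stab_power: "(x::'a::monoid_mult) \<in> mult_stab V \<Longrightarrow> x ^ n \<in> mult_stab V"
  by (induction n) (auto simp: mult_stab_1 mult_stab_mult)

locale field_emb =
  fixes emb :: "'k::field \<Rightarrow> 'a::field"
  assumes is_emb: "is_field_emb emb"
begin

lemma emb_add: "emb (x + y) = emb x + emb y"
  and emb_mult: "emb (x * y) = emb x * emb y"
  and emb_1: "emb 1 = 1"
  using is_emb by (auto simp: is_field_emb_def)

lemma emb_0: "emb 0 = 0"
  using emb_add[of 0 0] by (metis add.right_neutral add_left_cancel)

lemma emb_nonzero: "emb x \<noteq> 0" if "x \<noteq> 0"
proof
  assume "emb x = 0"
  then have "emb (x * inverse x) = 0" by (simp add: emb_mult)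
  then show False using that emb_1 by simp
qed

lemma emb_eq_0_iff: "emb x = 0 \<longleftrightarrow> x = 0"
  using emb_0 emb_nonzero by blast

sublocale vector_space "kscale emb"
  by unfold_locales (simp_all add: kscale_def algebra_simps emb_add emb_mult emb_1)

lemma subspace_mult_emb: "subspace U \<Longrightarrow> x \<in> U \<Longrightarrow> emb c * x \<in> U"
  using subspace_scale[of U x c] by (simp add: kscale_def)

text \<open>An infinite basis has \<open>card\<close> 0, so comparisons of \<open>dim\<close> need
  finiteness as a separate predicate.\<close>

definition fin_dim :: "'a set \<Rightarrow> bool" where
  "fin_dim U \<longleftrightarrow> (\<exists>S. finite S \<and> U \<subseteq> span S)"

section \<open>Bases and dimension counts\<close>

lemma fin_dim_subset: "fin_dim V \<Longrightarrow> U \<subseteq> V \<Longrightarrow> fin_dim U"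
  by (auto simp: fin_dim_def)

lemma fin_dim_span: "fin_dim (span U)" if "fin_dim U"
  using that by (metis fin_dim_def span_minimal subspace_span)

lemma fin_dim_Un:
  assumes "fin_dim U" "fin_dim V"
  shows "fin_dim (U \<union> V)"
proof -
  obtain S T where "finite S" "U \<subseteq> span S" "finite T" "V \<subseteq> span T"
    using assms by (auto simp: fin_dim_def)
  moreover have "span S \<union> span T \<subseteq> span (S \<union> T)"
    by (simp add: span_mono)
  ultimately show ?thesis
    unfolding fin_dim_def by (intro exI[of _ "S \<union> T"]) auto
qed

lemma fin_dim_independent_finite: "finite C" if "fin_dim U" "C \<subseteq> U" "independent C"
  using that independent_span_bound unfolding fin_dim_def by blast

lemma fin_dim_basis:
  assumes "fin_dim U"
  obtains C where "finite C" "independent C" "C \<subseteq> U" "U \<subseteq> span C" "card C = dim U"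
  using assms basis_exists[of U] fin_dim_independent_finite by metis

lemma dim_mono: "dim U \<le> dim V" if "fin_dim V" "U \<subseteq> V"
  by (metis dim_le_card fin_dim_basis order.trans that)

lemma dim_subset_eq: 
  assumes "fin_dim V" "subspace U" "U \<subseteq> V" "dim V \<le> dim U"
  shows "U = V"
proof (rule ccontr)
  assume "U \<noteq> V"
  then obtain v where v: "v \<in> V" "v \<notin> U" using assms by auto
  obtain C where C: "finite C" "independent C" "C \<subseteq> U" "U \<subseteq> span C" "card C = dim U"
    using fin_dim_basis[OF fin_dim_subset[OF assms(1,3)]] by blast
  have vC: "v \<notin> span C" using v C assms span_minimal by blast
  then have i: "independent (insert v C)" using C independent_insertI by blast
  have "card (insert v C) = dim U + 1" using C vC span_base[of v C] by (subst card_insert_disjoint) auto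
  moreover have "card (insert v C) = dim (insert v C)" using i dim_eq_card_independent by simp
  moreover have "dim (insert v C) \<le> dim V" using dim_mono[OF assms(1)] C v assms by simp
  ultimately show False using assms by simp
qed

text \<open>Extend a basis \<open>D\<close> of \<open>U\<close> to a basis \<open>E\<close> of
  \<open>span (U \<union> V)\<close>. The new vectors lie in \<open>V\<close>, and together with a
  basis of \<open>U \<inter> V\<close> they span \<open>V\<close>.\<close>

lemma dim_sum_Int_ge:
  assumes "subspace U" "subspace V" "fin_dim U" "fin_dim V"
  shows "dim U + dim V \<le> dim (span (U \<union> V)) + dim (U \<inter> V)"
proof -
  obtain C where C: "finite C" "independent C" "C \<subseteq> U \<inter> V" "U \<inter> V \<subseteq> span C" "card C = dim (U \<inter> V)"
    using fin_dim_basis[OF fin_dim_subset[OF assms(3)], of "U \<inter> V"] by blast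
  obtain D where D: "finite D" "independent D" "D \<subseteq> U" "U \<subseteq> span D" "card D = dim U"
    using fin_dim_basis[OF assms(3)] by blast
  obtain E where E: "D \<subseteq> E" "E \<subseteq> U \<union> V" "independent E" "U \<union> V \<subseteq> span E"
    using maximal_independent_subset_extend[of D "U \<union> V"] D by blast
  have finE: "finite E"
    using fin_dim_independent_finite[OF fin_dim_Un[OF assms(3,4)]] E by blast
  have cE: "dim (span (U \<union> V)) = card E"
    using E by (metis dim_span dim_unique)
  have ED: "E - D \<subseteq> V"
  proof
    fix e assume e: "e \<in> E - D"
    have "e \<notin> U"
    proof
      assume "e \<in> U"
      then have "e \<in> span (E - {e})" using D E e span_mono[of D "E - {e}"] by auto
      then show False using E e by (auto simp: dependent_def)
    qed
    then show "e \<in> V" using E e by auto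
  qed
  have "V \<subseteq> span (C \<union> (E - D))"
  proof
    fix v assume v: "v \<in> V"
    have "D \<union> (E - D) = E" using E by auto
    then have "v \<in> span (D \<union> (E - D))" using v E by auto
    then obtain u d where ud: "v = u + d" "u \<in> span D" "d \<in> span (E - D)"
      unfolding span_Un by blast
    have "d \<in> V" using ud ED assms span_minimal by blast
    moreover have "u \<in> U" using ud D assms span_minimal by blast
    moreover have "u = v - d" using ud by simp
    ultimately have "u \<in> U \<inter> V" using v assms subspace_diff by auto
    then have "u \<in> span C" using C by auto
    then show "v \<in> span (C \<union> (E - D))" using ud by (auto simp: span_Un)
  qed
  then have "dim V \<le> card (C \<union> (E - D))" using dim_le_card C finE by blast
  also have "\<dots> \<le> card C + (card E - card D)"
    using card_Un_le[of C "E - D"] card_Diff_subset[of D E] D E by simp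
  finally show ?thesis using C D E cE card_mono[OF finE E(1)] by simp
qed

lemma dim_disjoint_le:
  assumes "subspace U" "subspace V" "fin_dim W" "subspace W" "U \<subseteq> W" "V \<subseteq> W" "U \<inter> V \<subseteq> {0}"
  shows "dim U + dim V \<le> dim W"
proof -
  have "dim U + dim V \<le> dim (span (U \<union> V)) + dim (U \<inter> V)"
    using dim_sum_Int_ge assms fin_dim_subset by metis
  moreover have "dim (U \<inter> V) \<le> card ({}::'a set)"
    by (rule dim_le_card) (use assms in auto)
  moreover have "dim (span (U \<union> V)) \<le> dim W"
    using dim_mono[OF assms(3)] assms span_minimal[of "U \<union> V" W] by auto
  ultimately show ?thesis by simp
qed

section \<open>Multiplication by a fixed element as a linear map\<close>

lemma linear_mult: "Vector_Spaces.linear (kscale emb) (kscale emb) ((*) x)"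
  by unfold_locales (simp_all add: kscale_def algebra_simps)

lemma subspace_image_mult:
  assumes "subspace U"
  shows "subspace ((*) x ` U)"
proof -
  interpret l: Vector_Spaces.linear "kscale emb" "kscale emb" "(*) x" by (rule linear_mult)
  show ?thesis using assms by (rule l.subspace_image)
qed

lemma subspace_vimage_mult:
  assumes "subspace U"
  shows "subspace {y. x * y \<in> U}"
proof -
  interpret l: Vector_Spaces.linear "kscale emb" "kscale emb" "(*) x" by (rule linear_mult)
  show ?thesis using assms by (rule l.subspace_linear_preimage)
qed

lemma fin_dim_image_mult: "fin_dim ((*) x ` U)" if "fin_dim U"
proof -
  interpret l: Vector_Spaces.linear "kscale emb" "kscale emb" "(*) x" by (rule linear_mult)
  show ?thesis using that unfolding fin_dim_def by (meson finite_imageI l.spans_image)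
qed

lemma dim_image_mult:
  assumes "x \<noteq> 0"
  shows "dim ((*) x ` U) = dim U"
proof -
  interpret l: Vector_Spaces.linear "kscale emb" "kscale emb" "(*) x" by (rule linear_mult)
  obtain C where C: "C \<subseteq> U" "independent C" "U \<subseteq> span C" "card C = dim U"
    using basis_exists by blast
  have inj: "inj ((*) x)" using assms by (auto simp: inj_on_def)
  have "independent ((*) x ` C)" using C inj l.independent_inj_image by blast
  then have "dim ((*) x ` U) = card ((*) x ` C)"
    using C l.spans_image by (metis dim_unique image_mono)
  then show ?thesis using C inj by (simp add: card_image inj_on_subset)
qed

lemma mult_span_subset:
  assumes "subspace W" "\<And>x y. x \<in> A \<Longrightarrow> y \<in> B \<Longrightarrow> x * y \<in> W" "x \<in> span A" "y \<in> span B"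
  shows "x * y \<in> W"
proof -
  have 1: "x * y \<in> W" if "x \<in> A" for x
    using span_minimal[OF _ subspace_vimage_mult[OF assms(1)], of B x] assms(2,4) that by auto
  have "span A \<subseteq> {x. y * x \<in> W}"
    by (rule span_minimal[OF _ subspace_vimage_mult[OF assms(1)]]) (use 1 in \<open>auto simp: mult.commute\<close>)
  then show ?thesis using assms(3) by (auto simp: mult.commute)
qed

lemma fin_dim_set_prods:
  assumes "fin_dim A" "fin_dim B"
  shows "fin_dim (set_prods A B)"
proof -
  obtain S T where S: "finite S" "A \<subseteq> span S" and T: "finite T" "B \<subseteq> span T"
    using assms by (auto simp: fin_dim_def)
  have "set_prods S T = (\<lambda>(x, y). x * y) ` (S \<times> T)" by (auto simp: set_prods_def)
  then have "finite (set_prods S T)" using S T by simp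
  moreover have "set_prods A B \<subseteq> span (set_prods S T)"
    using mult_span_subset[of "span (set_prods S T)" S T] S T
    by (auto simp: set_prods_def[of A B] intro: set_prodsI span_base)
  ultimately show ?thesis by (auto simp: fin_dim_def)
qed

section \<open>Stabilisers of subspaces\<close>

lemma subspace_mult_stab: "subspace (mult_stab V)" if "subspace V"
  using that subspace_add[OF that] subspace_scale[OF that] subspace_0[OF that]
  by (auto simp: subspace_def mult_stab_def kscale_def distrib_right mult.assoc)

text \<open>A multiplier is determined by its value at a nonzero \<open>v\<close>; this makes
  stabilisers finite-dimensional.\<close>

lemma mult_stab_subset: "mult_stab V \<subseteq> (*) (inverse v) ` V" if "v \<in> V" "v \<noteq> 0" for v :: 'a
proof
  fix x assume "x \<in> mult_stab V"
  then have "x * v \<in> V" using that by (auto simp: mult_stab_def)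
  moreover have "x = inverse v * (x * v)" using that by simp
  ultimately show "x \<in> (*) (inverse v) ` V" by blast
qed

lemma fin_dim_mult_stab: "fin_dim (mult_stab V)" if "fin_dim V" "v \<in> V" "v \<noteq> 0"
  using mult_stab_subset that fin_dim_image_mult fin_dim_subset by metis

text \<open>Multiplication by \<open>x \<noteq> 0\<close> is injective on the finite-dimensional
  \<open>V\<close>, hence onto. The case \<open>x = 0\<close> rests on
  \<open>inverse 0 = 0\<close>.\<close>

lemma mult_stab_inverse:
  assumes "subspace V" "fin_dim V" "x \<in> mult_stab V"
  shows "inverse x \<in> mult_stab V"
proof (cases "x = 0")
  case False
  have "(*) x ` V = V"
    by (rule dim_subset_eq) (use assms False in \<open>auto simp: subspace_image_mult dim_image_mult mult_stab_def\<close>)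
  then have "\<exists>w\<in>V. v = x * w" if "v \<in> V" for v using that by blast
  then have "inverse x * v \<in> V" if "v \<in> V" for v using that False by (metis left_inverse mult.assoc mult_1)
  then show ?thesis by (simp add: mult_stab_def)
qed (use assms in simp)

text \<open>Dyson's e-transform replaces the pair \<open>A\<close>, \<open>B\<close> by \<open>A \<inter> (a/e)B\<close>, \<open>B + (e/a)A\<close>, which keeps
  the sum of the dimensions and does not enlarge the product.  It is the identity for all \<open>e\<close> only
  if \<open>A/a\<close> stabilises \<open>B\<close>.\<close>

lemma Dyson_transform:
  assumes "subspace A" "subspace B" "fin_dim A" "fin_dim B" "a \<in> A" "a \<noteq> 0" "B \<noteq> {0}"
  shows "\<exists>V. subspace V \<and> (\<forall>b\<in>B. a * b \<in> V) \<and> V \<subseteq> span (set_prods A B) \<and>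
    dim A + dim B \<le> dim V + dim (mult_stab V)"
  using assms
proof (induction "dim A" arbitrary: A B rule: less_induct)
  case less
  note subs = less.prems(1,2) and fd = less.prems(3,4) and a = less.prems(5,6)
  show ?case
  proof (cases "\<forall>e\<in>B. \<forall>x\<in>A. x * e / a \<in> B")
    case True
    \<comment> \<open>Here \<open>A / a\<close> maps \<open>B\<close> into itself and so stabilises
      \<open>aB\<close>: the stabiliser accounts for \<open>dim A\<close> and \<open>V\<close> for
      \<open>dim B\<close>.\<close>
    define V where "V = (*) a ` B"
    obtain b where b: "b \<in> B" "b \<noteq> 0" using less.prems(7) subspace_0[OF subs(2)] by auto
    have V: "subspace V" "fin_dim V" "a * b \<in> V" "a * b \<noteq> 0"
      using subs fd a b by (auto simp: V_def subspace_image_mult fin_dim_image_mult)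
    have "(*) (inverse a) ` A \<subseteq> mult_stab V"
    proof
      fix y assume "y \<in> (*) (inverse a) ` A"
      then obtain x where x: "x \<in> A" "y = inverse a * x" by auto
      have "y * v \<in> V" if "v \<in> V" for v
      proof -
        have "\<exists>e\<in>B. v = a * e" using that by (auto simp: V_def)
        then obtain e where "e \<in> B" "v = a * e" by blast
        then have "y * v = a * (x * e / a)" "x * e / a \<in> B" using True x a by (auto simp: field_simps)
        then show ?thesis unfolding V_def by (metis imageI)
      qed
      then show "y \<in> mult_stab V" by (auto simp: mult_stab_def)
    qed
    then have "dim ((*) (inverse a) ` A) \<le> dim (mult_stab V)"
      using dim_mono fin_dim_mult_stab V by metis
    moreover have "V \<subseteq> span (set_prods A B)"
      using a by (auto simp: V_def intro!: span_base set_prodsI)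
    ultimately show ?thesis
      using V a dim_image_mult[of a B] dim_image_mult[of "inverse a" A]
      by (intro exI[of _ V]) (auto simp: V_def)
  next
    case False
    then obtain e x0 where e: "e \<in> B" and x0: "x0 \<in> A" "x0 * e / a \<notin> B" by auto
    have e0: "e \<noteq> 0" using x0 subspace_0[OF subs(2)] by auto
    \<comment> \<open>The transform at \<open>e\<close>: \<open>a\<close> survives in
      \<open>A1\<close> because \<open>c * a = e\<close> lies in \<open>B\<close>, while
      \<open>x0\<close> is lost, so the induction on \<open>dim A\<close> applies.\<close>
    define c where "c = e / a"
    have c: "c \<noteq> 0" "c * a = e" using e0 a by (auto simp: c_def)
    define A1 where "A1 = A \<inter> {x. c * x \<in> B}"
    define U where "U = (*) c ` A"
    define B1 where "B1 = span (B \<union> U)"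
    have U: "subspace U" "fin_dim U" using subs fd by (auto simp: U_def subspace_image_mult fin_dim_image_mult)
    have A1: "subspace A1" "fin_dim A1" "A1 \<subseteq> A" "a \<in> A1"
      using subs fd a e c fin_dim_subset[OF fd(1), of A1]
      by (auto simp: A1_def subspace_vimage_mult intro!: subspace_inter)
    have "x0 \<notin> A1" using x0 by (auto simp: A1_def c_def field_simps)
    then have dA1: "dim A1 < dim A"
      using dim_subset_eq[OF fd(1) A1(1,3)] x0 by (metis not_less)
    have B1: "subspace B1" "fin_dim B1" "B \<subseteq> B1"
      using U fd by (auto simp: B1_def fin_dim_span fin_dim_Un intro: span_base)
    have "B1 \<noteq> {0}" using B1 e e0 by auto
    then obtain V where V: "subspace V" "\<forall>b\<in>B1. a * b \<in> V" "V \<subseteq> span (set_prods A1 B1)"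
      "dim A1 + dim B1 \<le> dim V + dim (mult_stab V)"
      using less.hyps[OF dA1 A1(1) B1(1) A1(2) B1(2) A1(4) a(2)] by blast
    \<comment> \<open>The two summands of \<open>B1\<close> meet in a copy of \<open>A1\<close>, so
      what the first factor loses the second gains.\<close>
    have "U \<inter> B = (*) c ` A1" by (auto simp: U_def A1_def)
    then have "dim (U \<inter> B) = dim A1" using c by (simp add: dim_image_mult)
    moreover have "dim U = dim A" using c by (simp add: U_def dim_image_mult)
    moreover have "dim U + dim B \<le> dim B1 + dim (U \<inter> B)"
      using dim_sum_Int_ge[OF U(1) subs(2) U(2) fd(2)] by (simp add: B1_def Un_commute)
    ultimately have "dim A + dim B \<le> dim V + dim (mult_stab V)" using V(4) by simp
    moreover have "set_prods A1 B1 \<subseteq> span (set_prods A B)"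
    proof -
      \<comment> \<open>A new factor \<open>c * z\<close> hands its \<open>c\<close> over:
        \<open>x * (c * z) = z * (c * x)\<close>, and \<open>c * x\<close> is in \<open>B\<close>
        for \<open>x\<close> in \<open>A1\<close>.\<close>
      have gen: "x * y \<in> span (set_prods A B)" if x: "x \<in> A1" and y: "y \<in> B \<union> U" for x y
        using y
      proof
        assume "y \<in> B"
        then show ?thesis using x A1 by (auto intro: span_base set_prodsI)
      next
        assume "y \<in> U"
        then obtain z where z: "z \<in> A" "y = c * z" by (auto simp: U_def)
        then have "x * y = z * (c * x)" by simp
        moreover have "c * x \<in> B" using x by (simp add: A1_def)
        ultimately show ?thesis using z by (metis span_base set_prodsI)
      qed
      show ?thesis
        using mult_span_subset[OF subspace_span gen, of A1 "B \<union> U"] span_base[of _ A1]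
        by (auto simp: set_prods_def[of A1] B1_def)
    qed
    then have "V \<subseteq> span (set_prods A B)" using V(3) span_minimal subspace_span by blast
    ultimately show ?thesis using V B1 by (intro exI[of _ V]) auto
  qed
qed

end

section \<open>Extension of scalars to Laurent series\<close>

unbundle fps_syntax

definition fls_map :: "('b::zero \<Rightarrow> 'c::zero) \<Rightarrow> 'b fls \<Rightarrow> 'c fls" where
  "fls_map f x = Abs_fls (\<lambda>n. f (x $$ n))"

lemma fls_map_nth: "fls_map f x $$ n = f (x $$ n)" if "f 0 = 0"
proof -
  obtain N where "\<forall>n<N. x $$ n = 0" by (rule fls_nth_vanishes_belowE)
  then show ?thesis unfolding fls_map_def
    by (intro nth_Abs_fls_lower_bound[of N]) (simp add: that)
qed

text \<open>With bounds chosen freely instead of subdegrees, one index range serves both for a pair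
  of series and for its image under a coefficient map.\<close>

lemma fls_times_nth_bounds:
  fixes f g :: "'b::semiring_0 fls"
  assumes "\<And>i. i < N \<Longrightarrow> f $$ i = 0" "\<And>i. i < M \<Longrightarrow> g $$ i = 0"
  shows "(f * g) $$ n = (\<Sum>i=N..n - M. f $$ i * g $$ (n - i))"
proof (cases "f = 0 \<or> g = 0")
  case False
  have "N \<le> fls_subdegree f" "M \<le> fls_subdegree g"
    using assms False by (auto intro: fls_subdegree_geI)
  then have "(\<Sum>i=fls_subdegree f..n - fls_subdegree g. f $$ i * g $$ (n - i))
      = (\<Sum>i=N..n - M. f $$ i * g $$ (n - i))"
    by (intro sum.mono_neutral_left) (auto simp: not_le)
  then show ?thesis by (simp add: fls_times_nth(2))
qed auto

text \<open>This is \<open>U((t))\<close>, for finite-dimensional \<open>U\<close> the scalar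
  extension of \<open>U\<close> to \<open>K((t))\<close>.\<close>

definition fls_space :: "'b::zero set \<Rightarrow> 'b fls set" where
  "fls_space U = {f. \<forall>n. f $$ n \<in> U}"

lemma fls_times_shift_const_nth:
  fixes x :: "'b::comm_ring_1 fls"
  shows "(x * fls_shift (- k) (fls_const c)) $$ n = x $$ (n - k) * c"
proof -
  have "x * fls_shift (- k) (fls_const c) = fls_shift (- k) (x * fls_const c)"
    by (simp add: fls_shifted_times_simps)
  then show ?thesis by simp
qed

text \<open>The Euler operator \<open>t d/dt\<close>, a derivation for which the monomials are eigenvectors.\<close>

definition fls_euler :: "'b::ring_1 fls \<Rightarrow> 'b fls" where
  "fls_euler f = fls_X * fls_deriv f"

lemma fls_euler_nth: "fls_euler f $$ n = of_int n * f $$ n"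
  by (simp add: fls_euler_def fls_X_times_conv_shift)

lemma fls_euler_add: "fls_euler (f + g) = fls_euler f + fls_euler g"
  by (simp add: fls_euler_def distrib_left)

lemma fls_euler_mult: "fls_euler (f * g) = fls_euler f * g + f * fls_euler g"
  for f g :: "'b::comm_ring_1 fls"
  by (simp add: fls_euler_def algebra_simps)

lemma fls_euler_const: "fls_euler (fls_const c) = 0"
  by (simp add: fls_euler_def)

text \<open>The Frobenius map is additive on finite sums, so \<open>x\<close> is cut into its terms
  of degree at most \<open>M = |n|\<close> and a tail. The terms include degree
  \<open>n div q\<close>, and the \<open>q\<close>-th power of the tail starts above degree
  \<open>n\<close>.\<close>

lemma fls_Frobenius_nth:
  fixes x :: "'b::idom fls"
  assumes "prime CHAR('b)" "q = CHAR('b) ^ k"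
  shows "(x ^ q) $$ n = (if int q dvd n then (x $$ (n div int q)) ^ q else 0)"
proof -
  obtain N where N: "\<forall>n<N. x $$ n = 0" by (rule fls_nth_vanishes_belowE)
  have q: "q > 0" using assms prime_gt_0_nat by simp
  define M where "M = \<bar>n\<bar>"
  define r where "r = Abs_fls (\<lambda>i. if i < 0 then 0 else x $$ (i + M + 1))"
  have r: "r $$ i = (if i < 0 then 0 else x $$ (i + M + 1))" for i
    unfolding r_def by (rule nth_Abs_fls_lower_bound[of 0]) simp
  define y where "y i = fls_shift (- i) (fls_const (x $$ i))" for i
  have ynth: "y i $$ j = (if j = i then x $$ i else 0)" for i j
    by (simp add: y_def)
  have "x = (\<Sum>i=N..M. y i) + fls_shift (- (M + 1)) r"
    by (rule fls_eqI) (use N in \<open>auto simp: fls_nth_sum ynth r algebra_simps not_le\<close>)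
  then have "x ^ q = (\<Sum>i=N..M. y i) ^ q + (fls_shift (- (M + 1)) r) ^ q"
    using freshmans_dream'[where ?'a = "'b fls", of q k] assms by simp
  also have "(\<Sum>i=N..M. y i) ^ q = (\<Sum>i=N..M. y i ^ q)"
    using freshmans_dream_sum'[where ?'a = "'b fls", of q k] assms by simp
  finally have "(x ^ q) $$ n = (\<Sum>i=N..M. (y i ^ q) $$ n) + ((fls_shift (- (M + 1)) r) ^ q) $$ n"
    by (simp add: fls_nth_sum)
  also have "((fls_shift (- (M + 1)) r) ^ q) $$ n = 0"
  proof -
    have "fls_subdegree r \<ge> 0" by (rule fls_subdegree_ge0I) (simp add: r)
    then have "fls_subdegree (r ^ q) \<ge> 0" by (rule fls_pow_subdegree_ge0)
    moreover have "n + int q * (- (M + 1)) < 0"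
    proof -
      have "1 * (M + 1) \<le> int q * (M + 1)" using q by (intro mult_right_mono) (auto simp: M_def)
      moreover have "n + int q * (- (M + 1)) = n - int q * (M + 1)" by (simp add: algebra_simps)
      moreover have "n < 1 * (M + 1)" by (simp add: M_def)
      ultimately show ?thesis by linarith
    qed
    ultimately show ?thesis by (subst fls_shifted_pow) simp
  qed
  also have "(\<Sum>i=N..M. (y i ^ q) $$ n) = (\<Sum>i=N..M. if n = int q * i then (x $$ i) ^ q else 0)"
    by (intro sum.cong refl) (simp add: y_def fls_shifted_pow flip: fls_const_power)
  also have "\<dots> = (if int q dvd n then (x $$ (n div int q)) ^ q else 0)"
  proof (cases "int q dvd n")
    case True
    then obtain j where j: "n = int q * j" by auto
    have jM: "j \<le> M"
    proof -
      have "1 * \<bar>j\<bar> \<le> int q * \<bar>j\<bar>" using q by (intro mult_right_mono) auto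
      then show ?thesis unfolding M_def j by (simp add: abs_mult)
    qed
    have "(\<Sum>i=N..M. if n = int q * i then (x $$ i) ^ q else 0) = (\<Sum>i=N..M. if i = j then (x $$ i) ^ q else 0)"
      using q j by (intro sum.cong) auto
    also have "\<dots> = (x $$ j) ^ q" using N jM q by (auto simp: not_le)
    finally show ?thesis using j q by simp
  qed (auto intro!: sum.neutral)
  finally show ?thesis by simp
qed

context field_emb
begin

section \<open>Scalar extension of the embedding and of subspaces\<close>

lemma emb_minus: "emb (- x) = - emb x"
  using emb_add[of x "- x"] emb_0 by (simp add: eq_neg_iff_add_eq_0 add.commute)

lemma emb_of_nat: "emb (of_nat n) = of_nat n"
  by (induction n) (simp_all add: emb_0 emb_1 emb_add)

lemma emb_of_int: "emb (of_int n) = of_int n"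
  by (cases n) (simp_all add: emb_of_nat emb_minus emb_add emb_1 del: of_nat_Suc)

lemma CHAR_emb: "CHAR('a) = CHAR('k)"
proof (rule CHAR_eqI)
  show "of_nat CHAR('k) = (0::'a)" using emb_of_nat[of "CHAR('k)"] emb_0 by simp
  show "CHAR('k) dvd n" if "of_nat n = (0::'a)" for n
    using that emb_of_nat[of n] emb_eq_0_iff[of "of_nat n"] of_nat_eq_0_iff_char_dvd[of n, where ?'a = 'k]
    by simp
qed

lemma emb_sum: "emb (sum f S) = (\<Sum>x\<in>S. emb (f x))"
  by (induction S rule: infinite_finite_induct) (simp_all add: emb_0 emb_add)

lemma emb_fls_map_nth: "fls_map emb x $$ n = emb (x $$ n)"
  by (simp add: fls_map_nth emb_0)

text \<open>This makes the results of the locale available over \<open>K((t))\<close>; that copy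
  carries the prefix \<open>T\<close>.\<close>

lemma field_emb_fls_map: "field_emb (fls_map emb)"
proof
  have "fls_map emb (f * g) = fls_map emb f * fls_map emb g" for f g
  proof (rule fls_eqI)
    fix n
    obtain N where N: "\<forall>n<N. f $$ n = 0" by (rule fls_nth_vanishes_belowE)
    obtain M where M: "\<forall>n<M. g $$ n = 0" by (rule fls_nth_vanishes_belowE)
    have "(f * g) $$ n = (\<Sum>i=N..n - M. f $$ i * g $$ (n - i))"
      by (rule fls_times_nth_bounds) (use N M in auto)
    moreover have "(fls_map emb f * fls_map emb g) $$ n
        = (\<Sum>i=N..n - M. fls_map emb f $$ i * fls_map emb g $$ (n - i))"
      by (rule fls_times_nth_bounds) (use N M in \<open>auto simp: emb_fls_map_nth emb_0\<close>)
    ultimately show "fls_map emb (f * g) $$ n = (fls_map emb f * fls_map emb g) $$ n"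
      by (simp add: emb_fls_map_nth emb_sum emb_mult)
  qed
  moreover have "fls_map emb (f + g) = fls_map emb f + fls_map emb g" for f g
    by (rule fls_eqI) (simp add: emb_fls_map_nth emb_add)
  moreover have "fls_map emb 1 = 1"
    by (rule fls_eqI) (simp add: emb_fls_map_nth emb_1 emb_0)
  ultimately show "is_field_emb (fls_map emb)" by (simp add: is_field_emb_def)
qed

lemma fls_space_mult:
  assumes "subspace W" "\<And>x y. x \<in> A \<Longrightarrow> y \<in> B \<Longrightarrow> x * y \<in> W" "f \<in> fls_space A" "g \<in> fls_space B"
  shows "f * g \<in> fls_space W"
  using assms unfolding fls_space_def by (auto simp: fls_times_nth(2) intro!: subspace_sum)

lemma fls_space_euler: "fls_euler f \<in> fls_space W" if "subspace W" "f \<in> fls_space W"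
  using that subspace_mult_emb[OF that(1), of _ "of_int _"]
  by (auto simp: fls_space_def fls_euler_nth emb_of_int)

interpretation T: field_emb "fls_map emb"
  by (rule field_emb_fls_map)

lemma subspace_fls_space:
  assumes "subspace U"
  shows "T.subspace (fls_space U)"
proof (rule T.subspaceI)
  fix c f assume "f \<in> fls_space U"
  \<comment> \<open>Scaling by \<open>K((t))\<close> is a product with a series whose coefficients
    lie in the image of \<open>K\<close>, so it falls under \<open>fls_space_mult\<close>.\<close>
  moreover have "fls_map emb c \<in> fls_space (range emb)"
    by (simp add: fls_space_def emb_fls_map_nth)
  ultimately show "kscale (fls_map emb) c f \<in> fls_space U"
    unfolding kscale_def using assms
    by (auto intro!: fls_space_mult[of U "range emb" U] subspace_mult_emb)
qed (use assms subspace_0 subspace_add in \<open>auto simp: fls_space_def\<close>)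

text \<open>A \<open>K\<close>-basis of \<open>U\<close>, read as constant series, is a
  \<open>K((t))\<close>-basis of \<open>U((t))\<close>: relations and expansions are checked one
  coefficient at a time.\<close>

lemma fls_space_basis:
  assumes "subspace U" "fin_dim U"
  shows fin_dim_fls_space: "T.fin_dim (fls_space U)"
    and dim_fls_space: "T.dim (fls_space U) = dim U"
proof -
  obtain C where C: "finite C" "independent C" "C \<subseteq> U" "U \<subseteq> span C" "card C = dim U"
    using fin_dim_basis[OF assms(2)] by blast
  have inj: "inj_on fls_const C"
    by (rule inj_onI) (metis fls_const_nth)
  have "T.independent (fls_const ` C)"
  proof (rule T.independent_if_scalars_zero)
    show "finite (fls_const ` C)" using C by simp
    fix g y
    assume "(\<Sum>y\<in>fls_const ` C. kscale (fls_map emb) (g y) y) = 0" and y: "y \<in> fls_const ` C"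
    then have s: "(\<Sum>u\<in>C. fls_map emb (g (fls_const u)) * fls_const u) = 0"
      by (simp add: sum.reindex[OF inj] kscale_def)
    obtain u where u: "u \<in> C" "y = fls_const u" using y by auto
    have "g y $$ n = 0" for n
    proof -
      have "(\<Sum>u\<in>C. fls_map emb (g (fls_const u)) * fls_const u) $$ n = 0" by (simp add: s)
      then have "(\<Sum>u\<in>C. kscale emb (g (fls_const u) $$ n) u) = 0"
        by (simp add: fls_nth_sum emb_fls_map_nth kscale_def)
      then show ?thesis
        using independentD[OF C(2) C(1) order.refl, of "\<lambda>u. g (fls_const u) $$ n"] u by simp
    qed
    then show "g y = 0" by (intro fls_zero_eqI)
  qed
  moreover have "fls_space U \<subseteq> T.span (fls_const ` C)"
  proof
    fix f assume f: "f \<in> fls_space U"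
    \<comment> \<open>The coordinates along \<open>u\<close> form a Laurent series, as they vanish
      wherever the coefficients of \<open>f\<close> do.\<close>
    define c where "c u = Abs_fls (\<lambda>n. representation C (f $$ n) u)" for u
    obtain N where N: "\<forall>n<N. f $$ n = 0" by (rule fls_nth_vanishes_belowE)
    have c: "c u $$ n = representation C (f $$ n) u" for u n
      unfolding c_def
      by (rule nth_Abs_fls_lower_bound[of N]) (use N in \<open>simp add: representation_zero\<close>)
    have "f = (\<Sum>u\<in>C. kscale (fls_map emb) (c u) (fls_const u))"
    proof (rule fls_eqI)
      fix n
      have "f $$ n \<in> span C" using f C by (auto simp: fls_space_def)
      then have "(\<Sum>u\<in>C. kscale emb (representation C (f $$ n) u) u) = f $$ n"
        using sum_representation_eq[OF C(2)] C(1) by blast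
      then show "f $$ n = (\<Sum>u\<in>C. kscale (fls_map emb) (c u) (fls_const u)) $$ n"
        by (simp add: fls_nth_sum kscale_def emb_fls_map_nth c)
    qed
    then show "f \<in> T.span (fls_const ` C)"
      by (metis (no_types, lifting) T.span_base T.span_scale T.span_sum image_eqI)
  qed
  moreover have "fls_const ` C \<subseteq> fls_space U"
    using C assms subspace_0 by (auto simp: fls_space_def)
  ultimately show "T.dim (fls_space U) = dim U" "T.fin_dim (fls_space U)"
    using T.dim_unique[of "fls_const ` C" "fls_space U"] C inj
    by (auto simp: card_image T.fin_dim_def)
qed

end

section \<open>Algebraic relations and separability\<close>

lemma pderiv_sum: "pderiv (sum f S) = (\<Sum>i\<in>S. pderiv (f i))"
  by (induction S rule: infinite_finite_induct) (simp_all add: pderiv_add)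

context field_emb
begin

section \<open>Linear relations in sequences\<close>

lemma in_span_relation:
  assumes "f n \<in> span (f ` {..<n::nat})"
  obtains c where "c n = 1" "(\<Sum>i\<le>n. emb (c i) * f i) = 0"
proof -
  define R where "R = {\<Sum>i<n. emb (c i) * f i |c. True}"
  have "subspace R"
  proof (rule subspaceI)
    have "(\<Sum>i<n. emb 0 * f i) = 0" by (simp add: emb_0)
    then show "0 \<in> R" unfolding R_def by force
  next
    fix x y assume "x \<in> R" "y \<in> R"
    then obtain c d where "x = (\<Sum>i<n. emb (c i) * f i)" "y = (\<Sum>i<n. emb (d i) * f i)"
      by (auto simp: R_def)
    then have "x + y = (\<Sum>i<n. emb (c i + d i) * f i)"
      by (simp add: emb_add sum.distrib distrib_right)
    then show "x + y \<in> R" unfolding R_def by (intro CollectI exI conjI) auto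
  next
    fix k x assume "x \<in> R"
    then obtain c where "x = (\<Sum>i<n. emb (c i) * f i)" by (auto simp: R_def)
    then have "kscale emb k x = (\<Sum>i<n. emb (k * c i) * f i)"
      by (simp add: kscale_def emb_mult sum_distrib_left mult.assoc)
    then show "kscale emb k x \<in> R" unfolding R_def by (intro CollectI exI conjI) auto
  qed
  moreover have "f j \<in> R" if "j < n" for j
  proof -
    have "(\<Sum>i<n. emb (if i = j then 1 else 0) * f i) = (\<Sum>i<n. if i = j then f i else 0)"
      by (intro sum.cong) (auto simp: emb_0 emb_1)
    then have "f j = (\<Sum>i<n. emb (if i = j then 1 else 0) * f i)" using that by simp
    then show ?thesis unfolding R_def by (intro CollectI exI conjI) auto
  qed
  ultimately have "span (f ` {..<n}) \<subseteq> R" by (intro span_minimal) auto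
  then obtain c where c: "f n = (\<Sum>i<n. emb (c i) * f i)" using assms by (auto simp: R_def)
  have "(\<Sum>i\<le>n. emb (((\<lambda>i. - c i)(n := 1)) i) * f i) = (\<Sum>i<n. emb (- c i) * f i) + f n"
    unfolding lessThan_Suc_atMost[symmetric] by (simp add: emb_1)
  also have "\<dots> = 0" by (simp add: c emb_minus sum_negf)
  finally show thesis using that[of "(\<lambda>i. - c i)(n := 1)"] by simp
qed

lemma independent_seq:
  assumes "\<And>j. j < n \<Longrightarrow> f j \<notin> span (f ` {..<j::nat})"
  shows "independent (f ` {..<n}) \<and> card (f ` {..<n}) = n"
  using assms
proof (induction n)
  case (Suc n)
  have "f n \<notin> span (f ` {..<n})" using Suc.prems by simp
  moreover from this have "f n \<notin> f ` {..<n}" using span_base by metis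
  ultimately show ?case using Suc
    by (simp add: lessThan_Suc independent_insertI)
qed (simp add: independent_empty)

text \<open>Otherwise every initial segment would be independent, exceeding \<open>dim U\<close>; a
  repeated value counts as a relation. For a sequence of powers this yields a monic
  polynomial.\<close>

lemma fin_dim_relation:
  assumes "fin_dim U" "\<And>i. f i \<in> U"
  obtains n c where "c n = 1" "(\<Sum>i\<le>n::nat. emb (c i) * f i) = 0"
proof -
  have "\<exists>n. f n \<in> span (f ` {..<n})"
  proof (rule ccontr)
    assume "\<nexists>n. f n \<in> span (f ` {..<n})"
    then have *: "independent (f ` {..<n}) \<and> card (f ` {..<n}) = n" for n
      by (intro independent_seq) auto
    have "card (f ` {..<Suc (dim U)}) = dim (f ` {..<Suc (dim U)})"
      using * dim_eq_card_independent by metis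
    also have "\<dots> \<le> dim U" by (rule dim_mono) (use assms in auto)
    finally show False using * by simp
  qed
  then show thesis using in_span_relation that by metis
qed

section \<open>Evaluation, minimal polynomials and separability\<close>

abbreviation evl :: "'k poly \<Rightarrow> 'a \<Rightarrow> 'a" where
  "evl p x \<equiv> poly (map_poly emb p) x"

lemma evl_pCons: "evl (pCons a p) x = emb a + x * evl p x"
  by (simp add: map_poly_pCons emb_0)

lemma evl_add: "evl (p + q) x = evl p x + evl q x"
proof (induction p arbitrary: q)
  case (pCons a p)
  then show ?case by (cases q) (simp add: evl_pCons emb_add algebra_simps)
qed simp

lemma evl_smult: "evl (smult c p) x = emb c * evl p x"
  by (induction p) (simp_all add: evl_pCons emb_mult algebra_simps)

lemma evl_mult: "evl (p * q) x = evl p x * evl q x"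
  by (induction p) (simp_all add: evl_add evl_smult evl_pCons emb_0 algebra_simps)

lemma evl_monom: "evl (monom c n) x = emb c * x ^ n"
  by (simp add: map_poly_monom emb_0 poly_monom)

lemma evl_sum: "evl (sum f S) x = (\<Sum>i\<in>S. evl (f i) x)"
  by (induction S rule: infinite_finite_induct) (simp_all add: evl_add)

lemma algebraic_overI:
  assumes "c n = 1" "(\<Sum>i\<le>n::nat. emb (c i) * x ^ (m * i)) = 0" "m > 0"
  shows "algebraic_over emb x"
proof -
  define P where "P = (\<Sum>i\<le>n. monom (c i) (m * i))"
  have "coeff P (m * n) = (\<Sum>i\<le>n. if i = n then c i else 0)"
    unfolding P_def coeff_sum by (intro sum.cong) (use assms(3) in auto)
  then have "coeff P (m * n) = 1" using assms(1) by simp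
  then have "P \<noteq> 0" by auto
  moreover have "evl P x = 0" using assms(2) by (simp add: P_def evl_sum evl_monom)
  ultimately show ?thesis unfolding algebraic_over_def by blast
qed

text \<open>A nonzero polynomial \<open>m\<close> of least degree vanishing at \<open>x\<close>
  divides all others that vanish there, by division with remainder. Irreducibility makes
  \<open>f\<close> an associate of \<open>m\<close>.\<close>

lemma irreducible_dvd_of_root:
  assumes "irreducible f" "evl f x = 0" "evl g x = 0"
  shows "f dvd g"
proof -
  have "\<exists>m. m \<noteq> 0 \<and> evl m x = 0" using assms by (intro exI[of _ f]) auto
  then obtain m where m: "m \<noteq> 0" "evl m x = 0"
    and min: "\<And>h. h \<noteq> 0 \<Longrightarrow> evl h x = 0 \<Longrightarrow> degree m \<le> degree h"
    using ex_has_least_nat[of "\<lambda>m. m \<noteq> 0 \<and> evl m x = 0" _ degree] by metis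
  have dvd: "m dvd h" if "evl h x = 0" for h
  proof -
    have "evl h x = evl (h div m * m) x + evl (h mod m) x"
      by (simp flip: evl_add)
    then have "evl (h mod m) x = 0" using that m by (simp add: evl_mult)
    then have "h mod m = 0" using min[of "h mod m"] degree_mod_less'[of m h] m by fastforce
    then show ?thesis by auto
  qed
  obtain k where k: "f = m * k" using dvd[OF assms(2)] by auto
  have "\<not> is_unit m"
  proof
    assume "is_unit m"
    then obtain u where "m * u = 1" by (metis dvdE)
    then have "evl m x * evl u x = 1" using evl_mult[of m u x] emb_1 by simp
    then show False using m by simp
  qed
  then have "is_unit k" using assms(1) k irreducibleD by blast
  then have "f dvd m" using k by (simp add: mult_unit_dvd_iff)
  then show ?thesis using dvd[OF assms(3)] dvd_trans by blast
qed

text \<open>Write \<open>g = f^k * r\<close> with \<open>0 < k < CHAR('k)\<close>. Then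
  \<open>pderiv g = 0\<close> makes \<open>f\<close> divide \<open>k * pderiv f * r\<close>;
  \<open>k\<close> is invertible and \<open>f\<close> does not divide \<open>pderiv f\<close>, so
  \<open>f\<close> divides \<open>r\<close>.\<close>

lemma separable_power_dvd:
  fixes f g :: "'k poly"
  assumes f: "irreducible f" "separable_poly f" and g: "f dvd g" "pderiv g = 0"
    and k: "k \<le> CHAR('k)"
  shows "f ^ k dvd g"
  using k
proof (induction k)
  case (Suc k)
  have prime: "prime_elem f" using f(1) by (rule field_poly_irreducible_imp_prime)
  have nu: "\<not> is_unit f" and f0: "f \<noteq> 0" using f(1) by (auto simp: irreducible_def)
  show ?case
  proof (cases "k = 0")
    case False
    obtain r where r: "g = f ^ k * r" using Suc by auto
    have "pderiv g = f ^ (k - 1) * (smult (of_nat k) (pderiv f * r) + f * pderiv r)"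
    proof -
      obtain l where l: "k = Suc l" using False by (cases k) auto
      have "pderiv g = f ^ Suc l * pderiv r + r * (smult (of_nat k) (f ^ l) * pderiv f)"
        unfolding r l pderiv_mult pderiv_power_Suc ..
      then show ?thesis by (simp add: l algebra_simps)
    qed
    then have "smult (of_nat k) (pderiv f * r) = f * (- pderiv r)"
      using g(2) f0 by (simp add: eq_neg_iff_add_eq_0)
    then have "f dvd smult (of_nat k) (pderiv f * r)" by simp
    moreover have "(of_nat k :: 'k) \<noteq> 0"
      using Suc.prems False by (auto simp: of_nat_eq_0_iff_char_dvd dest: dvd_imp_le)
    ultimately have "f dvd pderiv f * r" by (rule dvd_smult_cancel)
    moreover have "\<not> f dvd pderiv f"
      using f(2) nu by (meson separable_poly_def coprime_common_divisor dvd_refl)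
    ultimately have "f dvd r" using prime by (simp add: prime_elem_dvd_mult_iff)
    then show ?thesis unfolding r by (simp add: mult_dvd_mono mult.commute)
  qed (use g in simp)
qed simp

text \<open>A relation between the powers of \<open>v ^ p\<close> is a polynomial with zero derivative, so it is divisible
  by the \<open>p\<close>-th power of the minimal polynomial of \<open>v\<close>.  Hence \<open>v\<close> and \<open>v ^ p\<close> have the same degree.\<close>

lemma separable_mem_of_power_char:
  assumes "separable_over emb v" "p = CHAR('k)" "p > 0"
    and S: "subspace S" "1 \<in> S" "\<And>x y. x \<in> S \<Longrightarrow> y \<in> S \<Longrightarrow> x * y \<in> S" and v: "v ^ p \<in> S"
  shows "v \<in> S"
proof -
  obtain f where f: "irreducible f" "evl f v = 0" "separable_poly f"
    using assms(1) by (auto simp: separable_over_def)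
  define d where "d = degree f"
  have f0: "f \<noteq> 0" using f(1) by auto
  define w where "w i = v ^ (p * i)" for i
  have "w n \<notin> span (w ` {..<n})" if "n < d" for n
  proof
    assume "w n \<in> span (w ` {..<n})"
    then obtain c where c: "c n = 1" "(\<Sum>i\<le>n. emb (c i) * w i) = 0" by (rule in_span_relation)
    \<comment> \<open>A polynomial in \<open>X^p\<close> of degree at most \<open>p * n\<close>, too
      small for a nonzero multiple of \<open>f^p\<close>, whose degree is
      \<open>p * d\<close>.\<close>
    define g where "g = (\<Sum>i\<le>n. monom (c i) (p * i))"
    have "coeff g (p * n) = (\<Sum>i\<le>n. if i = n then c i else 0)"
      unfolding g_def coeff_sum by (intro sum.cong) (use assms(3) in auto)
    then have g0: "g \<noteq> 0" using c(1) by auto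
    have "evl g v = 0" using c(2) by (simp add: g_def evl_sum evl_monom w_def)
    then have "f dvd g" using irreducible_dvd_of_root f by blast
    moreover have "pderiv g = 0"
      by (simp add: g_def pderiv_sum pderiv_monom assms(2))
    ultimately have "f ^ p dvd g" using separable_power_dvd f assms by blast
    then have "p * d \<le> degree g" using g0 dvd_imp_degree_le[of "f ^ p" g]
      by (simp add: degree_power_eq f0 d_def)
    also have "degree g \<le> p * n" unfolding g_def
      by (rule degree_sum_le) (auto intro: order.trans[OF degree_monom_le])
    finally show False using that assms(3) by simp
  qed
  then have w: "independent (w ` {..<d})" "card (w ` {..<d}) = d"
    using independent_seq[of d w] by auto
  define U where "U = span ((\<lambda>i. v ^ i) ` {..<d})"
  have fdU: "fin_dim U" unfolding U_def fin_dim_def by blast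
  have "v ^ d \<in> U"
  proof -
    have "evl f v = (\<Sum>i\<le>d. emb (coeff f i) * v ^ i)"
      by (simp add: poly_altdef degree_map_poly coeff_map_poly emb_0 emb_eq_0_iff d_def)
    then have "(\<Sum>i<d. emb (coeff f i) * v ^ i) + emb (lead_coeff f) * v ^ d = 0"
      using f(2) by (simp add: d_def flip: lessThan_Suc_atMost)
    then have "emb (lead_coeff f) * v ^ d = - (\<Sum>i<d. emb (coeff f i) * v ^ i)"
      by (simp add: add_eq_0_iff)
    moreover have "emb (inverse (lead_coeff f)) * (emb (lead_coeff f) * v ^ d) = v ^ d"
      unfolding mult.assoc[symmetric] emb_mult[symmetric] using f0 by (simp add: emb_1)
    ultimately have "v ^ d = emb (inverse (lead_coeff f)) * (- (\<Sum>i<d. emb (coeff f i) * v ^ i))"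
      by simp
    moreover have "(\<Sum>i<d. emb (coeff f i) * v ^ i) \<in> U"
      unfolding U_def by (intro span_sum subspace_mult_emb subspace_span span_base) auto
    ultimately show ?thesis
      using subspace_mult_emb[OF subspace_span span_neg] by (simp add: U_def)
  qed
  then have vU: "v * x \<in> U" if "x \<in> U" for x
  proof -
    have "v * v ^ i \<in> U" if "i < d" for i
    proof (cases "Suc i = d")
      case True
      then show ?thesis using \<open>v ^ d \<in> U\<close> by auto
    next
      case False
      then have "v ^ Suc i \<in> (\<lambda>i. v ^ i) ` {..<d}" using that by (intro imageI) auto
      then show ?thesis unfolding U_def using span_base by fastforce
    qed
    then have "(\<lambda>i. v ^ i) ` {..<d} \<subseteq> {y. v * y \<in> U}" by auto
    then have "U \<subseteq> {y. v * y \<in> U}"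
      unfolding U_def by (rule span_minimal) (intro subspace_vimage_mult subspace_span)
    then show ?thesis using that by auto
  qed
  have powU: "v ^ i \<in> U" for i
  proof (induction i)
    case 0
    show ?case
    proof (cases "d = 0")
      case False
      then have "v ^ 0 \<in> (\<lambda>i. v ^ i) ` {..<d}" by (intro imageI) auto
      then show ?thesis unfolding U_def by (rule span_base)
    qed (use \<open>v ^ d \<in> U\<close> in simp)
  qed (simp add: vU)
  \<comment> \<open>\<open>d\<close> independent powers of \<open>v^p\<close> inside a space of
    dimension at most \<open>d\<close> fill it, so \<open>v\<close> is a combination of them, and
    they all lie in \<open>S\<close>.\<close>
  have "span (w ` {..<d}) = U"
  proof (rule dim_subset_eq[OF fdU subspace_span])
    show "span (w ` {..<d}) \<subseteq> U"
      using powU by (intro span_minimal) (auto simp: w_def U_def)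
    have "dim U \<le> card ((\<lambda>i. v ^ i) ` {..<d})" unfolding U_def by (rule dim_le_card) auto
    also have "\<dots> \<le> d" using card_image_le[of "{..<d}"] by simp
    finally show "dim U \<le> dim (span (w ` {..<d}))" using w by (simp add: dim_eq_card_independent)
  qed
  moreover have "w i \<in> S" for i
    unfolding w_def power_mult by (induction i) (use S v in auto)
  then have "span (w ` {..<d}) \<subseteq> S" using S by (intro span_minimal) auto
  ultimately show ?thesis using powU[of 1] by auto
qed

text \<open>Differentiating a shortest relation for \<open>x\<close> gives
  \<open>R + Q * \<delta> x = 0\<close>, with \<open>Q\<close> the formal derivative of the relation
  at \<open>x\<close>. By minimality and characteristic 0 \<open>Q\<close> is nonzero, and
  \<open>R\<close>, \<open>Q\<close> lie in the stabiliser, which is a field.\<close>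

lemma derivation_stable_mult_stab:
  fixes \<delta> :: "'a \<Rightarrow> 'a"
  assumes "CHAR('k) = 0"
    and add: "\<And>x y. \<delta> (x + y) = \<delta> x + \<delta> y"
    and mult: "\<And>x y. \<delta> (x * y) = \<delta> x * y + x * \<delta> y"
    and emb: "\<And>c. \<delta> (emb c) \<in> range emb"
    and V: "subspace V" "fin_dim V" "w \<in> V" "w \<noteq> 0" and x: "x \<in> mult_stab V"
  shows "\<delta> x \<in> mult_stab V"
proof -
  let ?H = "mult_stab V"
  \<comment> \<open>The top coefficient is only asked to be nonzero, so that the differentiated
    relation competes with the minimal one without rescaling.\<close>
  define rel where "rel n \<longleftrightarrow> (\<exists>c. c n \<noteq> 0 \<and> (\<Sum>i\<le>n. emb (c i) * x ^ i) = 0)" for n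
  obtain m c0 where "c0 m = 1" "(\<Sum>i\<le>m. emb (c0 i) * x ^ i) = 0"
    using fin_dim_relation[OF fin_dim_mult_stab[OF V(2-4)], of "\<lambda>i. x ^ i"] x mult_stab_power by metis
  then have "rel m" unfolding rel_def by (metis zero_neq_one)
  define n where "n = (LEAST n. rel n)"
  have "rel n" unfolding n_def using \<open>rel m\<close> by (rule LeastI)
  have nmin: "\<not> rel k" if "k < n" for k using that not_less_Least unfolding n_def by blast
  obtain c where c: "c n \<noteq> 0" "(\<Sum>i\<le>n. emb (c i) * x ^ i) = 0" using \<open>rel n\<close> by (auto simp: rel_def)
  obtain j where j: "n = Suc j"
    using c by (cases n) (auto simp: emb_eq_0_iff)
  have \<delta>0: "\<delta> 0 = 0" using add[of 0 0] by (metis add.right_neutral add_left_cancel)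
  have \<delta>1: "\<delta> 1 = 0" using mult[of 1 1] by (metis add.right_neutral add_left_cancel mult_1 mult_1_right)
  have \<delta>sum: "\<delta> (sum f S) = (\<Sum>i\<in>S. \<delta> (f i))" for f :: "nat \<Rightarrow> 'a" and S
    by (induction S rule: infinite_finite_induct) (simp_all add: \<delta>0 add)
  have \<delta>pow: "\<delta> (x ^ i) = of_nat i * x ^ (i - 1) * \<delta> x" for i
  proof (induction i)
    case (Suc i)
    then show ?case by (cases i) (simp_all add: mult \<delta>1 algebra_simps)
  qed (simp add: \<delta>1)
  define Q where "Q = (\<Sum>i\<le>j. emb (of_nat (Suc i) * c (Suc i)) * x ^ i)"
  define R where "R = (\<Sum>i\<le>n. \<delta> (emb (c i)) * x ^ i)"
  have "0 = \<delta> (\<Sum>i\<le>n. emb (c i) * x ^ i)" by (simp add: c \<delta>0)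
  also have "\<dots> = R + (\<Sum>i\<le>n. emb (c i) * (of_nat i * x ^ (i - 1))) * \<delta> x"
    unfolding R_def \<delta>sum mult \<delta>pow by (simp add: sum.distrib sum_distrib_right mult.assoc)
  also have "(\<Sum>i\<le>n. emb (c i) * (of_nat i * x ^ (i - 1))) = Q"
    unfolding j sum.atMost_Suc_shift Q_def
    by (simp add: emb_mult emb_of_nat emb_add emb_1 algebra_simps)
  finally have eq: "R + Q * \<delta> x = 0" by simp
  have "Q \<noteq> 0"
  proof
    assume "Q = 0"
    moreover have "of_nat (Suc j) * c (Suc j) \<noteq> 0"
      using c(1) assms(1) by (simp add: j CHAR_eq0_iff del: of_nat_Suc)
    ultimately have "rel j" unfolding rel_def Q_def by (intro exI[of _ "\<lambda>i. of_nat (Suc i) * c (Suc i)"]) simp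
    then show False using nmin j by simp
  qed
  have H: "subspace ?H" using V by (simp add: subspace_mult_stab)
  have "Q \<in> ?H" unfolding Q_def
    by (intro subspace_sum[OF H] subspace_mult_emb[OF H] mult_stab_power x)
  moreover have "\<delta> (emb (c i)) * x ^ i \<in> ?H" for i
    using emb[of "c i"] subspace_mult_emb[OF H mult_stab_power[OF x]] by auto
  then have "R \<in> ?H" unfolding R_def by (intro subspace_sum[OF H])
  ultimately have "inverse Q * (- R) \<in> ?H"
    using mult_stab_mult mult_stab_inverse V subspace_neg[OF H] by metis
  moreover have "\<delta> x = inverse Q * (- R)"
  proof -
    have "Q * \<delta> x = - R" using eq by (simp add: add_eq_0_iff)
    then have "inverse Q * (- R) = inverse Q * (Q * \<delta> x)" by simp
    then show ?thesis using \<open>Q \<noteq> 0\<close> by (simp flip: mult.assoc)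
  qed
  ultimately show ?thesis by simp
qed

end

section \<open>Kneser's theorem for field extensions\<close>

context field_emb
begin

text \<open>One \<open>p\<close>-th root is taken at a time: \<open>z = y^(p^k)\<close> is algebraic
  because the powers of \<open>z^p\<close> stay in the finite-dimensional \<open>S\<close>, so
  \<open>sep\<close> makes it separable.\<close>

lemma mem_of_power_char_power:
  assumes sep: "\<forall>a. algebraic_over emb a \<longrightarrow> separable_over emb a"
    and p: "p = CHAR('k)" "p > 0"
    and S: "subspace S" "fin_dim S" "1 \<in> S" "\<And>x y. x \<in> S \<Longrightarrow> y \<in> S \<Longrightarrow> x * y \<in> S"
    and y: "y ^ (p ^ k) \<in> S"
  shows "y \<in> S"
  using y
proof (induction k)
  case (Suc k)
  define z where "z = y ^ (p ^ k)"
  have z: "z ^ p \<in> S" using Suc.prems by (simp add: z_def mult.commute flip: power_mult)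
  then have "z ^ (p * i) \<in> S" for i
    unfolding power_mult by (induction i) (use S in auto)
  then obtain n c where "c n = 1" "(\<Sum>i\<le>n. emb (c i) * z ^ (p * i)) = 0"
    using fin_dim_relation[OF S(2), of "\<lambda>i. z ^ (p * i)"] by blast
  then have "separable_over emb z" using sep algebraic_overI p by blast
  then have "z \<in> S" using separable_mem_of_power_char p S z by blast
  then show ?case using Suc.IH by (simp add: z_def)
qed simp

interpretation T: field_emb "fls_map emb"
  by (rule field_emb_fls_map)

text \<open>Applying \<open>t d/dt - l\<close> removes the term of degree \<open>l\<close> and, in characteristic \<open>0\<close>, keeps all others.\<close>

lemma euler_separates:
  fixes \<alpha> :: "nat \<Rightarrow> 'a"
  assumes "CHAR('k) = 0" "finite I" "\<And>i. i \<in> I \<Longrightarrow> c i \<noteq> 0"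
    and W: "subspace W"
    and H: "\<And>x. x \<in> H \<Longrightarrow> fls_euler x \<in> H"
    and mem: "\<And>x. x \<in> H \<Longrightarrow>
      x * (\<Sum>i\<in>I. fls_shift (- int i) (fls_const (emb (c i) * \<alpha> i))) * fls_const b \<in> fls_space W"
    and "j \<in> I" "x \<in> H"
  shows "x $$ n * \<alpha> j * b \<in> W"
  using assms(2,3) mem \<open>j \<in> I\<close>
proof (induction "card I" arbitrary: I c rule: less_induct)
  case less
  define f where "f c I = (\<Sum>i\<in>I. fls_shift (- int i) (fls_const (emb (c i) * \<alpha> i)))" for c and I :: "nat set"
  have fnth: "f c I $$ k = (\<Sum>i\<in>I. if k = int i then emb (c i) * \<alpha> i else 0)" for c I k
    unfolding f_def fls_nth_sum by (intro sum.cong) auto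
  show ?case
  proof (cases "I = {j}")
    case True
    have "(x * f c I * fls_const b) $$ (n + int j) \<in> W"
      using less.prems(3) \<open>x \<in> H\<close> by (auto simp: f_def fls_space_def)
    moreover have "(x * f c I * fls_const b) $$ (n + int j) = emb (c j) * (x $$ n * \<alpha> j * b)"
      by (simp add: True f_def fls_times_shift_const_nth)
    ultimately have "emb (c j) * (x $$ n * \<alpha> j * b) \<in> W" by metis
    then have "emb (inverse (c j)) * (emb (c j) * (x $$ n * \<alpha> j * b)) \<in> W"
      by (rule subspace_mult_emb[OF W])
    moreover have "emb (inverse (c j)) * emb (c j) = 1"
      using less.prems by (simp add: emb_1 flip: emb_mult)
    ultimately show ?thesis by (simp flip: mult.assoc)
  next
    case False
    then obtain l where l: "l \<in> I" "l \<noteq> j" using less.prems(4) by blast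
    \<comment> \<open>The operator multiplies the term of degree \<open>i\<close> by
      \<open>i - l\<close>; this is why arbitrary nonzero coefficients \<open>c\<close> run through
      the induction.\<close>
    define c' where "c' i = of_int (int i - int l) * c i" for i
    have f': "f c' (I - {l}) = fls_euler (f c I) - of_int (int l) * f c I"
    proof (rule fls_eqI)
      fix k
      have "f c' (I - {l}) $$ k = (\<Sum>i\<in>I. if k = int i then emb (c' i) * \<alpha> i else 0)"
        unfolding fnth by (rule sum.mono_neutral_left) (use less.prems in \<open>auto simp: c'_def emb_0\<close>)
      also have "\<dots> = (\<Sum>i\<in>I. of_int (k - int l) * (if k = int i then emb (c i) * \<alpha> i else 0))"
        by (intro sum.cong) (auto simp: c'_def emb_mult emb_of_int[of "int _ - int _", simplified])
      also have "\<dots> = (fls_euler (f c I) - of_int (int l) * f c I) $$ k"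
        unfolding sum_distrib_left[symmetric] fnth[symmetric]
        by (simp add: fls_euler_nth left_diff_distrib)
      finally show "f c' (I - {l}) $$ k = (fls_euler (f c I) - of_int (int l) * f c I) $$ k" .
    qed
    have "x * f c' (I - {l}) * fls_const b \<in> fls_space W" if x: "x \<in> H" for x
    proof -
      define u where "u = x * f c I * fls_const b"
      have u: "u \<in> fls_space W" using less.prems(3) x by (simp add: u_def f_def)
      have v: "fls_euler x * f c I * fls_const b \<in> fls_space W" using less.prems(3) H x by (simp add: f_def)
      \<comment> \<open>The Leibniz rule isolates the term with \<open>fls_euler (f c I)\<close>;
        the term with \<open>fls_euler x\<close> is harmless because \<open>H\<close> is closed
        under the operator.\<close>
      have eu: "fls_euler u = fls_euler x * f c I * fls_const b + x * fls_euler (f c I) * fls_const b"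
        by (simp add: u_def fls_euler_mult fls_euler_const algebra_simps)
      have "x * f c' (I - {l}) * fls_const b =
          fls_euler u - fls_euler x * f c I * fls_const b - of_int (int l) * u"
        unfolding f' eu by (simp add: u_def algebra_simps)
      moreover have "of_int (int l) * w \<in> W" if "w \<in> W" for w
        using subspace_mult_emb[OF W that, of "of_int (int l)"] by (simp only: emb_of_int)
      ultimately show ?thesis
        using u v fls_space_euler[OF W u] W by (auto simp: fls_space_def intro!: subspace_diff)
    qed
    moreover have "card (I - {l}) < card I" using l less.prems by (intro psubset_card_mono) auto
    moreover have "c' i \<noteq> 0" if "i \<in> I - {l}" for i
    proof -
      have "(of_int (int i - int l) :: 'k) \<noteq> 0"
        using assms(1) that of_int_eq_0_iff_char_dvd[where ?'a = 'k, of "int i - int l"] by auto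
      then show ?thesis using less.prems(2) that by (simp add: c'_def)
    qed
    ultimately show ?thesis
      using less.hyps[of "I - {l}" c'] less.prems l by (auto simp: f_def)
  qed
qed

theorem linear_Kneser:
  assumes sep: "\<forall>a. algebraic_over emb a \<longrightarrow> separable_over emb a"
    and A: "subspace A" "fin_dim A" "A \<noteq> {0}" and B: "subspace B" "fin_dim B" "B \<noteq> {0}"
  defines "W \<equiv> span (set_prods A B)"
  shows "dim A + dim B \<le> dim W + dim (mult_stab W)"
proof -
  have W: "subspace W" "fin_dim W" using A B by (auto simp: W_def fin_dim_span fin_dim_set_prods)
  have AB: "x * y \<in> W" if "x \<in> A" "y \<in> B" for x y
    using that by (auto simp: W_def intro: span_base set_prodsI)
  obtain C where C: "finite C" "independent C" "C \<subseteq> A" "A \<subseteq> span C" "card C = dim A"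
    using fin_dim_basis[OF A(2)] by blast
  define m where "m = card C"
  obtain \<alpha> where \<alpha>: "\<alpha> ` {..<m} = C"
    using ex_bij_betw_nat_finite[OF C(1)] by (auto simp: m_def atLeast0LessThan bij_betw_def)
  have \<alpha>A: "\<alpha> i \<in> A" if "i < m" for i using that \<alpha> C by auto
  obtain b0 where b0: "b0 \<in> B" "b0 \<noteq> 0" using B subspace_0 by auto
  have "C \<noteq> {}" using A C subspace_0 by auto
  then have m: "m > 0" using C by (auto simp: m_def card_gt_0_iff)
  \<comment> \<open>By linearity, stability of \<open>W\<close> need only be tested on a basis of
    \<open>A\<close> times elements of \<open>B\<close>.\<close>
  have stabI: "y \<in> mult_stab W" if y: "\<And>i b. i < m \<Longrightarrow> b \<in> B \<Longrightarrow> y * \<alpha> i * b \<in> W" for y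
  proof -
    have "y * (x * b) \<in> W" if b: "b \<in> B" and x: "x \<in> A" for x b
    proof -
      have "C \<subseteq> {x. y * b * x \<in> W}" unfolding \<alpha>[symmetric] using y b by (auto simp: ac_simps)
      then have "span C \<subseteq> {x. y * b * x \<in> W}" by (rule span_minimal) (rule subspace_vimage_mult[OF W(1)])
      then show ?thesis using x C by (auto simp: ac_simps)
    qed
    then have "set_prods A B \<subseteq> {z. y * z \<in> W}" by (auto simp: set_prods_def)
    then have "W \<subseteq> {z. y * z \<in> W}"
      by (subst W_def) (intro span_minimal subspace_vimage_mult W)
    then show ?thesis by (auto simp: mult_stab_def)
  qed
  \<comment> \<open>The generic element: each basis vector of \<open>A\<close> sits in its own
    degree.\<close>
  define a where "a = (\<Sum>i<m. fls_shift (- int i) (fls_const (\<alpha> i)))"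
  have anth: "a $$ k = (\<Sum>i<m. if k = int i then \<alpha> i else 0)" for k
    unfolding a_def fls_nth_sum by (intro sum.cong) auto
  have aA: "a \<in> fls_space A"
    using \<alpha>A subspace_0[OF A(1)] by (auto simp: fls_space_def anth intro!: subspace_sum[OF A(1)])
  have "a $$ 0 = \<alpha> 0"
  proof -
    have "a $$ 0 = (\<Sum>i<m. if i = 0 then \<alpha> i else 0)"
      unfolding anth by (intro sum.cong) auto
    then show ?thesis using m by simp
  qed
  moreover have "\<alpha> 0 \<noteq> 0" using C(2) \<alpha> m dependent_zero by (metis imageI lessThan_iff)
  ultimately have a0: "a \<noteq> 0" by auto
  have const: "fls_const b \<in> fls_space B" if "b \<in> B" for b
    using that B subspace_0 by (auto simp: fls_space_def)
  have "fls_space B \<noteq> {0}" using const[OF b0(1)] b0(2) by auto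
  then obtain V where V: "T.subspace V" "\<forall>b\<in>fls_space B. a * b \<in> V"
    "V \<subseteq> T.span (set_prods (fls_space A) (fls_space B))"
    "T.dim (fls_space A) + T.dim (fls_space B) \<le> T.dim V + T.dim (mult_stab V)"
    using T.Dyson_transform[of "fls_space A" "fls_space B" a] aA a0
      subspace_fls_space fin_dim_fls_space A B by metis
  have "T.span (set_prods (fls_space A) (fls_space B)) \<subseteq> fls_space W"
    using fls_space_mult[OF W(1) AB]
    by (intro T.span_minimal subspace_fls_space W) (auto simp: set_prods_def)
  then have VW: "V \<subseteq> fls_space W" using V(3) by blast
  then have fdV: "T.fin_dim V" using T.fin_dim_subset fin_dim_fls_space[OF W] by blast
  define v where "v = a * fls_const b0"
  have v: "v \<in> V" "v \<noteq> 0" using V(2) const b0 a0 by (auto simp: v_def)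
  have key: "x * a * fls_const b \<in> fls_space W" if "x \<in> mult_stab V" "b \<in> B" for x b
    using that V(2) VW const by (force simp: mult_stab_def mult.assoc)
  have S: "subspace (mult_stab W)" "fin_dim (mult_stab W)"
  proof -
    have "\<alpha> 0 * b0 \<in> W" "\<alpha> 0 * b0 \<noteq> 0" using AB \<alpha>A m b0 \<open>\<alpha> 0 \<noteq> 0\<close> by auto
    then show "fin_dim (mult_stab W)" using fin_dim_mult_stab[OF W(2)] by blast
  qed (simp add: subspace_mult_stab W)
  \<comment> \<open>The heart of the descent: \<open>key\<close> constrains sums of products of
    coefficients of \<open>x\<close> and \<open>a\<close>, and these products must be
    separated.\<close>
  have "x $$ n \<in> mult_stab W" if x: "x \<in> mult_stab V" for x n
  proof (cases "CHAR('k) = 0")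
    case True
    show ?thesis
    proof (rule stabI)
      fix i b assume i: "i < m" and b: "b \<in> B"
      have eul: "fls_euler x \<in> mult_stab V" if "x \<in> mult_stab V" for x
      proof (rule T.derivation_stable_mult_stab[OF _ fls_euler_add fls_euler_mult _ V(1) fdV v that])
        fix c
        have "fls_euler (fls_map emb c) = fls_map emb (fls_euler c)"
          by (rule fls_eqI) (simp add: fls_euler_nth emb_fls_map_nth emb_mult emb_of_int)
        then show "fls_euler (fls_map emb c) \<in> range (fls_map emb)" by simp
      qed (use True in simp)
      show "x $$ n * \<alpha> i * b \<in> W"
      proof (rule euler_separates[OF True, of "{..<m}" "\<lambda>_. 1" W "mult_stab V" \<alpha> b i x n])
        fix x assume "x \<in> mult_stab V"
        then show "x * (\<Sum>i<m. fls_shift (- int i) (fls_const (emb 1 * \<alpha> i))) * fls_const b \<in> fls_space W"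
          using key[of x b] b by (simp add: emb_1 a_def)
      qed (use W eul i x in auto)
    qed
  next
    case False
    define p where "p = CHAR('k)"
    have p: "p = CHAR('k)" "p > 0" using False by (auto simp: p_def)
    have prime: "prime CHAR('a)" using prime_CHAR_semidom[where ?'a = 'a] False CHAR_emb by simp
    \<comment> \<open>With \<open>m < q\<close> the degrees \<open>q * j + i\<close>,
      \<open>i < m\<close>, are pairwise distinct, so those coefficients of
      \<open>x^q * a * b\<close> are single products.\<close>
    define q where "q = p ^ m"
    have "p > 1" using prime prime_gt_1_nat by (simp add: CHAR_emb p_def)
    then have mq: "m < q" unfolding q_def by (intro power_gt_expt) simp
    have Frob: "(x ^ q) $$ k = (if int q dvd k then (x $$ (k div int q)) ^ q else 0)" for k
      using fls_Frobenius_nth[OF prime, of q m x k] by (simp add: CHAR_emb q_def p_def)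
    have "(x $$ n) ^ q \<in> mult_stab W"
    proof (rule stabI)
      fix i b assume i: "i < m" and b: "b \<in> B"
      define k where "k = int q * n + int i"
      have "(x ^ q * a * fls_const b) $$ k = (\<Sum>j<m. (x ^ q) $$ (k - int j) * \<alpha> j) * b"
        by (simp add: a_def sum_distrib_left fls_nth_sum fls_times_shift_const_nth)
      also have "(\<Sum>j<m. (x ^ q) $$ (k - int j) * \<alpha> j) = (\<Sum>j<m. if j = i then (x $$ n) ^ q * \<alpha> j else 0)"
      proof (intro sum.cong refl)
        fix j assume j: "j \<in> {..<m}"
        show "(x ^ q) $$ (k - int j) * \<alpha> j = (if j = i then (x $$ n) ^ q * \<alpha> j else 0)"
        proof (cases "j = i")
          case True
          then show ?thesis using mq by (simp add: Frob k_def)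
        next
          case False
          have "\<not> int q dvd k - int j"
          proof
            assume "int q dvd k - int j"
            then have "int q dvd (int q * n + (int i - int j)) - int q * n" unfolding k_def
              by (intro dvd_diff) (simp_all add: algebra_simps)
            then have "int q dvd int i - int j" by simp
            then have "int q \<le> \<bar>int i - int j\<bar>" using False by (intro zdvd_imp_le) auto
            then show False using i j mq by auto
          qed
          then show ?thesis using False by (simp add: Frob)
        qed
      qed
      also have "\<dots> = (x $$ n) ^ q * \<alpha> i" using i by simp
      finally show "(x $$ n) ^ q * \<alpha> i * b \<in> W"
        using key[OF mult_stab_power[OF x] b, of q] unfolding fls_space_def by (metis mem_Collect_eq)
    qed
    then show ?thesis unfolding q_def
      using mem_of_power_char_power[OF sep p S mult_stab_1] mult_stab_mult by blast
  qed
  then have "mult_stab V \<subseteq> fls_space (mult_stab W)" by (auto simp: fls_space_def)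
  then have "T.dim (mult_stab V) \<le> dim (mult_stab W)"
    using T.dim_mono[OF fin_dim_fls_space[OF S]] dim_fls_space[OF S] by metis
  moreover have "T.dim V \<le> dim W"
    using T.dim_mono[OF fin_dim_fls_space[OF W] VW] dim_fls_space[OF W] by simp
  ultimately show ?thesis using V(4) dim_fls_space A B by simp
qed

end

section \<open>Growth of powers\<close>

lemma prod_set_pow_0: "prod_set_pow B 0 = {1}"
  by (simp add: prod_set_pow_def)

lemma prod_set_pow_Suc: "prod_set_pow B (Suc m) = set_prods (prod_set_pow B m) B"
proof (intro equalityI subsetI)
  fix z assume "z \<in> prod_set_pow B (Suc m)"
  then obtain f where f: "z = (\<Prod>i<Suc m. f i)" "\<forall>i<Suc m. f i \<in> B" by (auto simp: prod_set_pow_def)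
  then have "z = (\<Prod>i<m. f i) * f m" by simp
  moreover have "(\<Prod>i<m. f i) \<in> prod_set_pow B m" using f(2) by (auto simp: prod_set_pow_def)
  ultimately show "z \<in> set_prods (prod_set_pow B m) B" using f(2) by (metis lessI set_prodsI)
next
  fix z assume "z \<in> set_prods (prod_set_pow B m) B"
  then obtain f b where f: "z = (\<Prod>i<m. f i) * b" "\<forall>i<m. f i \<in> B" "b \<in> B"
    by (auto simp: prod_set_pow_def set_prods_def)
  have "(\<Prod>i<m. (f(m := b)) i) = (\<Prod>i<m. f i)" by (intro prod.cong) auto
  then have "z = (\<Prod>i<Suc m. (f(m := b)) i)" using f(1) by simp
  moreover have "\<forall>i<Suc m. (f(m := b)) i \<in> B" using f by (auto simp: less_Suc_eq)
  ultimately show "z \<in> prod_set_pow B (Suc m)" unfolding prod_set_pow_def by blast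
qed

context field_emb
begin

lemma span_mult_mem: "x \<in> span A \<Longrightarrow> y \<in> span B \<Longrightarrow> x * y \<in> span (set_prods A B)"
  using mult_span_subset[OF subspace_span, of A B] by (meson set_prodsI span_base)

text \<open>\<open>vH\<close> meets \<open>V\<close> only in 0: if \<open>v * h\<close> is in
  \<open>V\<close> with \<open>h \<noteq> 0\<close>, multiplying by \<open>inverse h\<close> puts
  \<open>v\<close> in \<open>V\<close>. So \<open>Q\<close> contains a direct sum of
  \<open>vH\<close> and \<open>V\<close>.\<close>

lemma dim_translate_le:
  assumes "subspace V" "fin_dim V" "subspace Q" "fin_dim Q" "subspace H" "V \<subseteq> Q" "H \<subseteq> mult_stab V"
    and inv: "\<And>h. h \<in> H \<Longrightarrow> inverse h \<in> H"
    and v: "v \<in> Q" "v \<notin> V" "\<And>h. h \<in> H \<Longrightarrow> v * h \<in> Q"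
  shows "dim H + dim V \<le> dim Q"
proof -
  have v0: "v \<noteq> 0" using v assms subspace_0 by auto
  have "(*) v ` H \<inter> V \<subseteq> {0}"
  proof
    fix y assume "y \<in> (*) v ` H \<inter> V"
    then obtain h where h: "h \<in> H" "y = v * h" "y \<in> V" by auto
    show "y \<in> {0}"
    proof (cases "h = 0")
      case False
      have "inverse h * y \<in> V" using inv[OF h(1)] h(3) assms(7) by (auto simp: mult_stab_def)
      moreover have "inverse h * y = v" using h(2) False by simp
      ultimately show ?thesis using v by simp
    qed (simp add: h)
  qed
  then have "dim ((*) v ` H) + dim V \<le> dim Q"
    using assms by (intro dim_disjoint_le subspace_image_mult) auto
  then show ?thesis using v0 by (simp add: dim_image_mult)
qed

text \<open>The index \<open>l\<close> stands for \<open>n - 1\<close>. The proof splits on whether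
  the \<open>H\<close>-spaces generated by \<open>P l\<close> and \<open>P (Suc l)\<close>
  differ.\<close>

theorem dim_power_growth:
  assumes sep: "\<forall>a. algebraic_over emb a \<longrightarrow> separable_over emb a"
    and B: "subspace B" "fin_dim B" "1 \<in> B"
  defines "P \<equiv> \<lambda>k. span (prod_set_pow B k)"
  shows "P (Suc (Suc l)) = P (Suc l) \<or> dim (P l) + dim B \<le> dim (P (Suc (Suc l)))"
proof -
  have subP: "subspace (P k)" for k by (simp add: P_def)
  have fdP: "fin_dim (P k)" for k
  proof (induction k)
    case 0
    have "fin_dim {1}" unfolding fin_dim_def by (meson finite.emptyI finite.insertI span_superset)
    then show ?case by (simp add: P_def prod_set_pow_0 fin_dim_span)
  next
    case (Suc k)
    then have "fin_dim (prod_set_pow B k)" using fin_dim_subset span_superset unfolding P_def by metis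
    then show ?case using B by (simp add: P_def prod_set_pow_Suc fin_dim_span fin_dim_set_prods)
  qed
  have PB: "x * b \<in> P (Suc k)" if "x \<in> P k" "b \<in> B" for x b k
    using that unfolding P_def prod_set_pow_Suc by (intro span_mult_mem) (auto intro: span_base)
  have PSuc: "P (Suc k) \<subseteq> U" if "subspace U" "\<And>x b. x \<in> P k \<Longrightarrow> b \<in> B \<Longrightarrow> x * b \<in> U" for U k
    unfolding P_def prod_set_pow_Suc
    by (rule span_minimal[OF _ that(1)]) (use that(2) in \<open>auto simp: P_def set_prods_def intro: span_base\<close>)
  have Pmono: "P k \<subseteq> P (Suc k)" for k
    using PB[of _ k 1] B(3) by auto
  have P1: "1 \<in> P k" for k
    using Pmono by (induction k) (auto simp: P_def prod_set_pow_0 intro: span_base)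
  define W where "W = P (Suc (Suc l))"
  define H where "H = mult_stab W"
  have W: "subspace W" "fin_dim W" "1 \<in> W" using subP fdP P1 by (auto simp: W_def)
  have H: "subspace H" "fin_dim H" "1 \<in> H"
    using W fin_dim_mult_stab[OF W(2,3)] by (auto simp: H_def subspace_mult_stab mult_stab_1)
  have HH: "x * y \<in> H" if "x \<in> H" "y \<in> H" for x y using that by (simp add: H_def mult_stab_mult)
  have Hinv: "inverse x \<in> H" if "x \<in> H" for x using that W by (simp add: H_def mult_stab_inverse)
  have HW: "x * y \<in> W" if "x \<in> H" "y \<in> W" for x y using that by (simp add: H_def mult_stab_def)
  define Q where "Q k = span (set_prods H (P k))" for k
  have subQ: "subspace (Q k)" for k by (simp add: Q_def)
  have fdQ: "fin_dim (Q k)" for k using H fdP by (simp add: Q_def fin_dim_span fin_dim_set_prods)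
  have PQ: "P k \<subseteq> Q k" for k
    using set_prodsI[OF H(3)] by (fastforce simp: Q_def intro: span_base)
  have Qmono: "Q k \<subseteq> Q (Suc k)" for k
    unfolding Q_def using Pmono[of k] by (intro span_mono) (auto simp: set_prods_def)
  have HQ: "H \<subseteq> mult_stab (Q k)" for k
  proof
    fix h assume h: "h \<in> H"
    have "set_prods H (P k) \<subseteq> {y. h * y \<in> Q k}"
      using HH[OF h] by (auto simp: Q_def set_prods_def[of H] intro!: span_base)
        (metis mult.assoc)
    then have "Q k \<subseteq> {y. h * y \<in> Q k}"
      by (subst Q_def) (intro span_minimal subspace_vimage_mult subQ)
    then show "h \<in> mult_stab (Q k)" by (auto simp: mult_stab_def)
  qed
  have QB: "x * b \<in> Q (Suc k)" if "x \<in> Q k" "b \<in> B" for x b k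
  proof -
    have "set_prods H (P k) \<subseteq> {y. b * y \<in> Q (Suc k)}"
    proof
      fix y assume "y \<in> set_prods H (P k)"
      then obtain h z where hz: "h \<in> H" "z \<in> P k" "y = h * z" by (auto simp: set_prods_def)
      then have "b * y = h * (z * b)" by (simp add: ac_simps)
      moreover have "h * (z * b) \<in> Q (Suc k)"
        unfolding Q_def using hz PB that(2) by (intro span_base set_prodsI) auto
      ultimately show "y \<in> {y. b * y \<in> Q (Suc k)}" by (metis mem_Collect_eq)
    qed
    then have "Q k \<subseteq> {y. b * y \<in> Q (Suc k)}"
      by (subst Q_def) (intro span_minimal subspace_vimage_mult subQ)
    then show ?thesis using that by (auto simp: mult.commute)
  qed
  show ?thesis
  proof (cases "Q l = Q (Suc l)")
    case False
    then obtain v where v: "v \<in> Q (Suc l)" "v \<notin> Q l" using Qmono by blast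
    \<comment> \<open>Both are spaces over the field \<open>H\<close>, so a strict inclusion gains
      at least \<open>dim H\<close>, which pays for the \<open>dim H\<close> in Kneser's
      inequality.\<close>
    have growth: "dim H + dim (Q l) \<le> dim (Q (Suc l))"
      by (rule dim_translate_le[OF subQ fdQ subQ fdQ H(1) Qmono HQ Hinv v])
         (use HQ v in \<open>auto simp: mult_stab_def mult.commute\<close>)
    define B1 where "B1 = span (set_prods H B)"
    have B1: "subspace B1" "fin_dim B1" "B \<subseteq> B1"
      using H B set_prodsI[OF H(3)]
      by (fastforce simp: B1_def intro: fin_dim_span fin_dim_set_prods span_base)+
    \<comment> \<open>Enlarging the factors by \<open>H\<close> does not enlarge the product, as
      \<open>W\<close> is already stable under \<open>H\<close>.\<close>
    have "set_prods (Q (Suc l)) B1 \<subseteq> W"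
    proof -
      have "x * y \<in> W" if xy: "x \<in> set_prods H (P (Suc l))" "y \<in> set_prods H B" for x y
      proof -
        obtain h z h' b where *: "x = h * z" "y = h' * b" "h \<in> H" "h' \<in> H" "z \<in> P (Suc l)" "b \<in> B"
          using xy unfolding set_prods_def by blast
        then have "h * h' * (z * b) \<in> W" using HW[OF HH] PB by (simp add: W_def)
        then show ?thesis using * by (simp add: ac_simps)
      qed
      then have "x * y \<in> W" if "x \<in> Q (Suc l)" "y \<in> B1" for x y
        using that mult_span_subset[OF W(1)] unfolding Q_def B1_def by blast
      then show ?thesis by (auto simp: set_prods_def[of "Q (Suc l)"])
    qed
    moreover have "W \<subseteq> span (set_prods (Q (Suc l)) B1)"
      unfolding W_def using PQ B1(3) by (intro PSuc) (auto intro!: span_base set_prodsI)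
    ultimately have "span (set_prods (Q (Suc l)) B1) = W"
      using span_minimal[OF _ W(1)] by blast
    moreover have "Q (Suc l) \<noteq> {0}" "B1 \<noteq> {0}" using PQ[of "Suc l"] P1[of "Suc l"] B1(3) B(3) by auto
    ultimately have "dim (Q (Suc l)) + dim B1 \<le> dim W + dim H"
      using linear_Kneser[OF sep subQ fdQ _ B1(1,2)] unfolding H_def by metis
    moreover have "dim (P l) \<le> dim (Q l)" "dim B \<le> dim B1"
      using dim_mono fdQ PQ B1 by auto
    ultimately show ?thesis using growth by (simp add: W_def)
  next
    case True
    \<comment> \<open>Now \<open>Q l\<close> absorbs multiplication by \<open>B\<close>, so
      \<open>W = Q l\<close> and \<open>B\<close> stabilises \<open>W\<close>. Hence all powers lie
      in \<open>H\<close>, and \<open>1 \<in> W\<close> gives \<open>W = H\<close>, a field.\<close>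
    have "W \<subseteq> Q l"
      unfolding W_def using PQ QB True by (intro PSuc[OF subQ]) blast
    moreover have "Q l \<subseteq> W"
    proof -
      have "P l \<subseteq> W" using Pmono by (auto simp: W_def)
      then have "set_prods H (P l) \<subseteq> W" using HW by (auto simp: set_prods_def)
      then show ?thesis unfolding Q_def by (rule span_minimal[OF _ W(1)])
    qed
    ultimately have WQ: "W = Q l" by blast
    have BH: "b \<in> H" if "b \<in> B" for b
      using QB[of _ l b] that True WQ by (auto simp: H_def mult_stab_def mult.commute)
    have PH: "P k \<subseteq> H" for k
    proof (induction k)
      case 0
      show ?case unfolding P_def prod_set_pow_0 using H by (intro span_minimal) auto
    next
      case (Suc k)
      then show ?case using HH BH by (intro PSuc H(1)) auto
    qed
    have WH: "W = H" using PH[of "Suc (Suc l)"] HW[OF _ W(3)] by (auto simp: W_def)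
    show ?thesis
    proof (cases "P (Suc l) = W")
      case False
      then obtain v where v: "v \<in> W" "v \<notin> P (Suc l)" using Pmono[of "Suc l"] by (auto simp: W_def)
      \<comment> \<open>With \<open>W = H\<close> Kneser's inequality says nothing. Dyson's
        transform with \<open>a = 1\<close>, applied to \<open>P l\<close> and \<open>B\<close>,
        yields a \<open>V\<close> inside \<open>P (Suc l)\<close>, which is strictly smaller than
        \<open>W\<close>.\<close>
      have spanP: "span (set_prods (P l) B) \<subseteq> P (Suc l)"
        using PB subP by (intro span_minimal) (auto simp: set_prods_def)
      have "B \<noteq> {0}" using B(3) by auto
      then obtain V where V: "subspace V" "\<forall>b\<in>B. 1 * b \<in> V" "V \<subseteq> span (set_prods (P l) B)"
        "dim (P l) + dim B \<le> dim V + dim (mult_stab V)"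
        using Dyson_transform[OF subP B(1) fdP B(2) P1 one_neq_zero, of l] by blast
      have VP: "V \<subseteq> P (Suc l)" using V spanP by blast
      then have VW: "V \<subseteq> W" "fin_dim V" using PH WH fin_dim_subset[OF fdP] by blast+
      have V1: "1 \<in> V" using V(2) B(3) by auto
      \<comment> \<open>As \<open>1\<close> is in \<open>V\<close>, the stabiliser of
        \<open>V\<close> lies in the field \<open>W\<close>, and so does its translate by
        \<open>v\<close>; this translate meets \<open>V\<close> only in 0, so \<open>W\<close> has
        room for both dimensions.\<close>
      have JV: "mult_stab V \<subseteq> V" using V1 by (force simp: mult_stab_def)
      have "dim (mult_stab V) + dim V \<le> dim W"
      proof (rule dim_translate_le[OF V(1) VW(2) W(1,2) subspace_mult_stab[OF V(1)] VW(1) order.refl _ v(1)])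
        show "v \<notin> V" using v VP by blast
        show "v * h \<in> W" if "h \<in> mult_stab V" for h
          using HH v(1) that JV VW(1) unfolding WH by blast
      qed (rule mult_stab_inverse[OF V(1) VW(2)])
      then show ?thesis using V(4) by (simp add: W_def)
    qed (simp add: W_def)
  qed
qed

end

theorem mainTheorem14:
  fixes emb :: "'k::field \<Rightarrow> 'a::field"
    and B :: "'a set"
    and n :: nat
  assumes "is_field_emb emb"
    and "\<forall>a. algebraic_over emb a \<longrightarrow> separable_over emb a"
    and "module.subspace (kscale emb) B"
    and "\<exists>S. finite S \<and> B = module.span (kscale emb) S"
    and "1 \<in> B"
    and "n \<ge> 1"
  shows "module.span (kscale emb) (prod_set_pow B (n + 1)) = module.span (kscale emb) (prod_set_pow B n)
    \<or> vector_space.dim (kscale emb) (module.span (kscale emb) (prod_set_pow B (n + 1)))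
        \<ge> vector_space.dim (kscale emb) (module.span (kscale emb) (prod_set_pow B (n - 1)))
          + vector_space.dim (kscale emb) B"
proof -
  interpret field_emb emb by (rule field_emb.intro) fact
  have "fin_dim B" using assms(4) by (auto simp: fin_dim_def)
  moreover obtain l where "n = Suc l" using assms(6) by (cases n) auto
  ultimately show ?thesis
    using dim_power_growth[OF assms(2,3) _ assms(5), of l] by simp
qed

end
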